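(* Let $B=(b(i,j))_{i,j\ge0}$ be the infinite lower triangular matrix with $b(i,j)=(-1)^{i-j}\frac{T_{2i-2j+1}}{2^{2i-2j+1}}\binom{2i+1}{2j}$ for $0\le j\le i$ and $b(i,j)=0$ for $j>i$. Then $$B=\bigl(l(2i+1,j)\bigr)_{i,j\ge0}\Bigl(\bigl(l(2i,j)\bigr)_{i,j\ge0}\Bigr)^{-1}=\bigl(U(i,j)\bigr)_{i,j\ge0}\left([i=j]\frac{2j+1}{2}\right)_{i,j\ge0}\bigl(u(i,j)\bigr)_{i,j\ge0}.$$
   Context: $[P]=1$ if $P$ holds and $0$ otherwise. All matrices are infinite lower triangular, indexed by $i,j\ge0$. The tangent numbers $T_{2k+1}$, $k\ge0$, are defined by $\frac{e^{2z}-1}{e^{2z}+1}=\sum_{k\ge0}(-1)^kT_{2k+1}\frac{z^{2k+1}}{(2k+1)!}$. The Lucas polynomials are $L_0(s)=2$, $L_1(s)=1$, $L_n(s)=L_{n-1}(s)+sL_{n-2}(s)$, and $l(n,k)$ denotes the coefficient of $s^k$ in $L_n(s)$. The numbers $U(n,k)$ and $u(n,k)$ are the generalized Stirling numbers of the second and first kind for the weights $w(n)=\left(\frac{2n+1}{2}\right)^2$: $U(0,k)=[k=0]$, $U(n,0)=w(0)^n$, $U(n,k)=U(n-1,k-1)+w(k)U(n-1,k)$ for $n,k\ge1$; $u(0,k)=[k=0]$, $u(n,0)=(-1)^n\prod_{j=0}^{n-1}w(j)$, $u(n,k)=u(n-1,k-1)-w(n-1)u(n-1,k)$ for $n,k\ge1$.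 *)

theory Defs
  imports Complex_Main "HOL-Computational_Algebra.Computational_Algebra"
begin

type_synonym inf_matrix = "nat \<Rightarrow> nat \<Rightarrow> real"

definition lower_tri :: "inf_matrix \<Rightarrow> bool" where
  "lower_tri A \<longleftrightarrow> (\<forall>i j. i < j \<longrightarrow> A i j = 0)"

(* The product is meant for a lower triangular left factor A: then the terms
   with k > i vanish, so cutting the sum off at k = i loses nothing. *)
definition mat_mult :: "inf_matrix \<Rightarrow> inf_matrix \<Rightarrow> inf_matrix" (infixl \<open>\<star>\<close> 70) where
  "A \<star> B = (\<lambda>i j. \<Sum>k\<le>i. A i k * B k j)"

definition mat_one :: inf_matrix where
  "mat_one = (\<lambda>i j. of_bool (i = j))"

definition is_inverse :: "inf_matrix \<Rightarrow> inf_matrix \<Rightarrow> bool" where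
  "is_inverse A X \<longleftrightarrow> lower_tri X \<and> A \<star> X = mat_one \<and> X \<star> A = mat_one"

definition invertible_ltri :: "inf_matrix \<Rightarrow> bool" where
  "invertible_ltri A \<longleftrightarrow> lower_tri A \<and> (\<exists>X. is_inverse A X)"

definition ltri_inv :: "inf_matrix \<Rightarrow> inf_matrix" where
  "ltri_inv A = (THE X. is_inverse A X)"

definition tangent_gf :: "real fps" where
  "tangent_gf = (fps_exp 2 - 1) / (fps_exp 2 + 1)"

(* T_n for odd n, read off from the exponential generating function
   tanh z = sum_k (-1)^k T_(2k+1) z^(2k+1) / (2k+1)!; for n = 2k+1 the sign exponent n div 2 is k.
   See tangent_gf_expansion below. *)
definition tangent_number :: "nat \<Rightarrow> real" where
  "tangent_number n = (-1) ^ (n div 2) * fact n * fps_nth tangent_gf n"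

fun lucas_poly :: "nat \<Rightarrow> real poly" where
  "lucas_poly 0 = [:2:]"
| "lucas_poly (Suc 0) = [:1:]"
| "lucas_poly (Suc (Suc n)) = lucas_poly (Suc n) + [:0, 1:] * lucas_poly n"

definition lucas_coeff :: "nat \<Rightarrow> nat \<Rightarrow> real" where
  "lucas_coeff n k = coeff (lucas_poly n) k"

fun gen_stirling2 :: "(nat \<Rightarrow> real) \<Rightarrow> nat \<Rightarrow> nat \<Rightarrow> real" where
  "gen_stirling2 w 0 k = of_bool (k = 0)"
| "gen_stirling2 w (Suc n) 0 = w 0 ^ Suc n"
| "gen_stirling2 w (Suc n) (Suc k) = gen_stirling2 w n k + w (Suc k) * gen_stirling2 w n (Suc k)"

fun gen_stirling1 :: "(nat \<Rightarrow> real) \<Rightarrow> nat \<Rightarrow> nat \<Rightarrow> real" where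
  "gen_stirling1 w 0 k = of_bool (k = 0)"
| "gen_stirling1 w (Suc n) 0 = (-1) ^ Suc n * (\<Prod>j<Suc n. w j)"
| "gen_stirling1 w (Suc n) (Suc k) = gen_stirling1 w n k - w n * gen_stirling1 w n (Suc k)"

definition weight :: "nat \<Rightarrow> real" where
  "weight n = ((2 * real n + 1) / 2)\<^sup>2"

abbreviation stirling_U :: inf_matrix where "stirling_U \<equiv> gen_stirling2 weight"

abbreviation stirling_u :: inf_matrix where "stirling_u \<equiv> gen_stirling1 weight"

definition B_mat :: inf_matrix where
  "B_mat = (\<lambda>i j. if j \<le> i
     then (-1) ^ (i - j) * (tangent_number (2 * (i - j) + 1) / 2 ^ (2 * (i - j) + 1))
          * real ((2 * i + 1) choose (2 * j))
     else 0)"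

lemma mat_mult_assoc:
  assumes "lower_tri A" "lower_tri B"
  shows "(A \<star> B) \<star> C = A \<star> (B \<star> C)"
proof (intro ext)
  fix i j
  have "((A \<star> B) \<star> C) i j = (\<Sum>k\<le>i. \<Sum>m\<le>i. A i m * B m k * C k j)"
    by (simp add: mat_mult_def sum_distrib_right)
  also have "\<dots> = (\<Sum>m\<le>i. \<Sum>k\<le>i. A i m * B m k * C k j)"
    by (rule sum.swap)
  also have "\<dots> = (\<Sum>m\<le>i. \<Sum>k\<le>m. A i m * B m k * C k j)"
    using assms(2) by (intro sum.cong refl sum.mono_neutral_right) (auto simp: lower_tri_def)
  also have "\<dots> = (A \<star> (B \<star> C)) i j"
    by (simp add: mat_mult_def sum_distrib_left mult.assoc)
  finally show "((A \<star> B) \<star> C) i j = (A \<star> (B \<star> C)) i j" .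
qed

lemma mat_one_left: "mat_one \<star> A = A"
  by (intro ext) (simp add: mat_mult_def mat_one_def)

lemma mat_one_right:
  assumes "lower_tri A"
  shows "A \<star> mat_one = A"
proof (intro ext)
  fix i j
  have "(A \<star> mat_one) i j = (\<Sum>k\<le>i. if k = j then A i k else 0)"
    unfolding mat_mult_def mat_one_def by (intro sum.cong) auto
  also have "\<dots> = A i j"
    using assms by (auto simp: lower_tri_def)
  finally show "(A \<star> mat_one) i j = A i j" .
qed

lemma ltri_inv_eqI:
  assumes A: "lower_tri A" and X: "is_inverse A X"
  shows "ltri_inv A = X"
  unfolding ltri_inv_def
proof (rule the_equality)
  show "is_inverse A X" by (fact X)
next
  fix Y assume Y: "is_inverse A Y"
  have "Y = (X \<star> A) \<star> Y"
    using X by (simp add: is_inverse_def mat_one_left)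
  also have "\<dots> = X \<star> (A \<star> Y)"
    using A X by (intro mat_mult_assoc) (auto simp: is_inverse_def)
  also have "\<dots> = X"
    using X Y by (simp add: is_inverse_def mat_one_right)
  finally show "Y = X" .
qed

lemma tangent_gf_nth_even:
  assumes "even n"
  shows "fps_nth tangent_gf n = 0"
proof -
  let ?E = "fps_exp 2 :: real fps"
  have nz: "fps_nth (?E + 1) 0 \<noteq> 0" by simp
  have F: "tangent_gf * (?E + 1) = ?E - 1"
    unfolding tangent_gf_def using nz by (metis fps_zero_nth dvd_div_mult_self fps_is_unit_iff unit_imp_dvd)
  have E: "?E oo - fps_X = fps_exp (- 2)"
    using fps_exp_compose_linear[of 2 "-1 :: real"] by (simp flip: fps_const_neg)
  have "(tangent_gf * (?E + 1)) oo - fps_X = (?E - 1) oo - fps_X"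
    by (simp only: F)
  hence 1: "(tangent_gf oo - fps_X) * (fps_exp (- 2) + 1) = fps_exp (- 2) - 1"
    by (simp add: fps_compose_mult_distrib fps_compose_add_distrib fps_compose_sub_distrib E)
  have inv: "fps_exp (- 2) * ?E = 1"
    by (simp flip: fps_exp_add_mult)
  have "(tangent_gf oo - fps_X) * ((fps_exp (- 2) + 1) * ?E) = (fps_exp (- 2) - 1) * ?E"
    using 1 by (simp flip: mult.assoc)
  hence "(tangent_gf oo - fps_X) * (?E + 1) = 1 - ?E"
    by (simp add: distrib_right left_diff_distrib inv add.commute)
  also have "\<dots> = (- tangent_gf) * (?E + 1)"
    by (simp add: F)
  finally have "tangent_gf oo - fps_X = - tangent_gf"
    using nz by (metis fps_zero_nth mult_right_cancel)
  hence "(-1) ^ n * fps_nth tangent_gf n = - fps_nth tangent_gf n"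
    using fps_compose_uminus'[of tangent_gf] by (simp add: fps_eq_iff)
  thus ?thesis using assms by simp
qed

lemma tangent_gf_expansion:
  "(fps_exp 2 - 1) / (fps_exp 2 + 1) =
     Abs_fps (\<lambda>n. if odd n then (-1) ^ (n div 2) * tangent_number n / fact n else 0)"
  unfolding tangent_gf_def[symmetric]
  by (rule fps_ext) (auto simp: tangent_number_def tangent_gf_nth_even simp flip: power_add mult.assoc)

lemma lucas_coeff_eq_0: "n < 2 * k \<Longrightarrow> lucas_coeff n k = 0"
  unfolding lucas_coeff_def
proof (induction n arbitrary: k rule: lucas_poly.induct)
  case (3 n)
  then obtain k' where "k = Suc k'" by (cases k) auto
  with 3 show ?case by simp
qed (auto simp: coeff_pCons split: nat.splits)

lemma gen_stirling2_eq_0: "n < k \<Longrightarrow> gen_stirling2 w n k = 0"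
  by (induction w n k rule: gen_stirling2.induct) auto

lemma gen_stirling1_eq_0: "n < k \<Longrightarrow> gen_stirling1 w n k = 0"
  by (induction w n k rule: gen_stirling1.induct) auto

lemma lower_tri_matrices:
  "lower_tri B_mat"
  "lower_tri (\<lambda>i j. lucas_coeff (2 * i + 1) j)"
  "lower_tri (\<lambda>i j. lucas_coeff (2 * i) j)"
  "lower_tri stirling_U"
  "lower_tri stirling_u"
  by (auto simp: lower_tri_def B_mat_def lucas_coeff_eq_0 gen_stirling2_eq_0 gen_stirling1_eq_0)

end

theory Submission
  imports Defs
begin

text \<open>
  With $s = y^2 - \frac14$ the Lucas polynomials become
  $L_n(s) = (\frac12 + y)^n + (\frac12 - y)^n$. Hence, for a lower triangular matrix $M$ with row
  polynomials $M_i(t) = \sum_j m(i,j) t^j$, the equation $M \cdot (l(2i,j)) = (l(2i+1,j))$ says that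
  $$M_i((y+{\textstyle\frac12})^2) + M_i((y-{\textstyle\frac12})^2)
    = (y+{\textstyle\frac12})^{2i+1} - (y-{\textstyle\frac12})^{2i+1}$$
  for all $i$ and $y$, that is, $M_i(x^2) = \tanh(D/2)\, x^{2i+1}$. For $B$ this is the
  exponential generating function $\tanh(z/2)\, e^{xz}$. For the Stirling product it holds because
  $x^{2i} = \sum_k U(i,k)\, p_k(x)$ with $p_k(x) = \prod_{j<k} (x^2 - (j+\frac12)^2)$, and
  $x\, p_k(x)$ is mapped to $\frac{2k+1}{2}\, p_k(x)$. As $(l(2i,j))$ is invertible, both
  factorizations follow.
\<close>

section \<open>Lower triangular matrices\<close>

text \<open>Forward substitution: row \<open>i\<close> of \<open>A \<star> X = mat_one\<close> is
  solved for \<open>X i j\<close> from the rows above it, which is meaningful when \<open>A\<close>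
  has no zero on its diagonal.\<close>

fun ltri_right_inv :: "inf_matrix \<Rightarrow> inf_matrix" where
  "ltri_right_inv A i j = (of_bool (i = j) - (\<Sum>k\<in>{..<i}. A i k * ltri_right_inv A k j)) / A i i"

declare ltri_right_inv.simps [simp del]

lemma lower_tri_ltri_right_inv: "lower_tri (ltri_right_inv A)"
proof -
  have "i < j \<Longrightarrow> ltri_right_inv A i j = 0" for i j
  proof (induction i rule: less_induct)
    case (less i)
    then show ?case
      by (subst ltri_right_inv.simps) simp
  qed
  then show ?thesis
    by (simp add: lower_tri_def)
qed

lemma ltri_right_inv_diag: "ltri_right_inv A i i = 1 / A i i"
  using lower_tri_ltri_right_inv[of A]
  by (subst ltri_right_inv.simps) (simp add: lower_tri_def)

lemma mat_mult_ltri_right_inv: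
  assumes "\<And>i. A i i \<noteq> 0"
  shows "A \<star> ltri_right_inv A = mat_one"
proof (intro ext)
  fix i j
  have "(A \<star> ltri_right_inv A) i j =
      (\<Sum>k<i. A i k * ltri_right_inv A k j) + A i i * ltri_right_inv A i j"
    by (simp add: mat_mult_def flip: lessThan_Suc_atMost)
  also have "\<dots> = mat_one i j"
    using assms by (subst (2) ltri_right_inv.simps) (simp add: mat_one_def)
  finally show "(A \<star> ltri_right_inv A) i j = mat_one i j" .
qed

text \<open>The right inverse \<open>X\<close> has a nonzero diagonal, hence a right inverse
  \<open>Y\<close> of its own. Then Y = (A X) Y = A (X Y) = A, so \<open>X\<close> is also a left
  inverse of \<open>A\<close>.\<close>

lemma is_inverse_ltri_right_inv:
  assumes A: "lower_tri A" and diag: "\<And>i. A i i \<noteq> 0"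
  shows "is_inverse A (ltri_right_inv A)"
proof -
  define X where "X = ltri_right_inv A"
  define Y where "Y = ltri_right_inv X"
  have X: "lower_tri X" and AX: "A \<star> X = mat_one"
    using lower_tri_ltri_right_inv mat_mult_ltri_right_inv diag by (auto simp: X_def)
  have XY: "X \<star> Y = mat_one"
    unfolding Y_def using diag
    by (intro mat_mult_ltri_right_inv) (simp add: X_def ltri_right_inv_diag)
  have "Y = (A \<star> X) \<star> Y"
    by (simp add: AX mat_one_left)
  also have "\<dots> = A"
    by (simp add: mat_mult_assoc A X XY mat_one_right)
  finally show ?thesis
    using X AX XY by (simp add: is_inverse_def flip: X_def)
qed

lemma lower_tri_mat_mult:
  assumes "lower_tri A" "lower_tri C"
  shows "lower_tri (A \<star> C)"
  unfolding lower_tri_def mat_mult_def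
proof (intro allI impI sum.neutral ballI)
  fix i j k :: nat
  assume "i < j" "k \<in> {..i}"
  then show "A i k * C k j = 0"
    using assms(2) by (simp add: lower_tri_def)
qed

section \<open>Row polynomials of lower triangular matrices\<close>

definition row_eval :: "inf_matrix \<Rightarrow> nat \<Rightarrow> real \<Rightarrow> real" where
  "row_eval A i x = (\<Sum>j\<le>i. A i j * x ^ j)"

lemma row_eval_mat_mult:
  assumes "lower_tri C"
  shows "row_eval (A \<star> C) i x = (\<Sum>k\<le>i. A i k * row_eval C k x)"
proof -
  have "row_eval (A \<star> C) i x = (\<Sum>j\<le>i. \<Sum>k\<le>i. A i k * (C k j * x ^ j))"
    by (simp add: row_eval_def mat_mult_def sum_distrib_right mult.assoc)
  also have "\<dots> = (\<Sum>k\<le>i. \<Sum>j\<le>i. A i k * (C k j * x ^ j))"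
    by (rule sum.swap)
  also have "\<dots> = (\<Sum>k\<le>i. \<Sum>j\<le>k. A i k * (C k j * x ^ j))"
    using assms by (intro sum.cong refl sum.mono_neutral_right) (auto simp: lower_tri_def)
  finally show ?thesis
    by (simp add: row_eval_def sum_distrib_left)
qed

text \<open>The difference of two row polynomials has infinitely many roots, so it is zero. Testing
  at x \<ge> 0 allows x to be written as y^2 - 1/4 with y real.\<close>

lemma lower_tri_eqI:
  assumes A: "lower_tri A" and C: "lower_tri C"
    and eq: "\<And>i x. x \<ge> 0 \<Longrightarrow> row_eval A i x = row_eval C i x"
  shows "A = C"
proof (intro ext)
  fix i j
  define p where "p = (\<Sum>k\<le>i. monom (A i k - C i k) k)"
  have "poly p x = row_eval A i x - row_eval C i x" for x
    by (simp add: p_def row_eval_def poly_sum poly_monom left_diff_distrib sum_subtractf)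
  then have "{0..} \<subseteq> {x. poly p x = 0}"
    by (auto simp: eq)
  moreover have "infinite {0::real..}"
    by (rule infinite_Ici)
  ultimately have "p = 0"
    using poly_roots_finite finite_subset by blast
  then have "coeff p j = 0"
    by simp
  then show "A i j = C i j"
    using A C by (cases "j \<le> i") (auto simp: p_def coeff_sum lower_tri_def)
qed

section \<open>Lucas polynomials\<close>

text \<open>For s = y^2 - 1/4 the roots of z^2 = z + s are 1/2 + y and 1/2 - y, so the powers of
  both obey the Lucas recurrence.\<close>

lemma poly_lucas_poly:
  "poly (lucas_poly n) (y\<^sup>2 - 1 / 4) = (1 / 2 + y) ^ n + (1 / 2 - y) ^ n"
proof (induction n rule: lucas_poly.induct)
  case (3 n)
  have "z ^ Suc (Suc n) = z ^ Suc n + (y\<^sup>2 - 1 / 4) * z ^ n" if "z\<^sup>2 = z + (y\<^sup>2 - 1 / 4)" for z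
    using arg_cong[OF that, of "\<lambda>t. t * z ^ n"] by (simp add: power2_eq_square algebra_simps)
  from this[of "1 / 2 + y"] this[of "1 / 2 - y"] show ?case
    using 3 by (simp add: power2_eq_square algebra_simps del: power_Suc)
qed simp_all

text \<open>The degree of \<open>lucas_poly n\<close> is at most \<open>n div 2\<close>, so the sum
  up to \<open>m\<close> misses no coefficient.\<close>

lemma sum_lucas_coeff:
  assumes "n \<le> 2 * m + 1"
  shows "(\<Sum>k\<le>m. lucas_coeff n k * x ^ k) = poly (lucas_poly n) x"
proof -
  have "degree (lucas_poly n) \<le> m"
    using assms lucas_coeff_eq_0[of n]
    by (intro degree_le) (auto simp: lucas_coeff_def)
  then show ?thesis
    unfolding poly_altdef lucas_coeff_def
    by (intro sum.mono_neutral_right) (auto simp: coeff_eq_0)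
qed

text \<open>This makes the even Lucas matrix invertible. The top coefficient of L_{2i+2} is
  inherited from s L_{2i}, since L_{2i+1} has degree at most i.\<close>

lemma lucas_coeff_diag: "lucas_coeff (2 * i) i = 2"
proof -
  have "lucas_coeff (2 * i) i = 2 \<and> lucas_coeff (2 * i + 1) i = 2 * real i + 1"
    by (induction i) (use lucas_coeff_eq_0 in \<open>simp_all add: lucas_coeff_def\<close>)
  then show ?thesis ..
qed

lemma mat_mult_lucas_even_eq_odd:
  assumes M: "lower_tri M"
    and eq: "\<And>i y. row_eval M i ((y + 1 / 2)\<^sup>2) + row_eval M i ((y - 1 / 2)\<^sup>2) =
      (y + 1 / 2) ^ (2 * i + 1) - (y - 1 / 2) ^ (2 * i + 1)"
  shows "M \<star> (\<lambda>i j. lucas_coeff (2 * i) j) = (\<lambda>i j. lucas_coeff (2 * i + 1) j)"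
proof (rule lower_tri_eqI)
  fix i and x :: real
  assume "x \<ge> 0"
  \<comment> \<open>The Lucas argument x = y^2 - 1/4 solved for y.\<close>
  define y where "y = sqrt (x + 1 / 4)"
  have x: "x = y\<^sup>2 - 1 / 4"
    using \<open>x \<ge> 0\<close> by (simp add: y_def)
  have "row_eval (M \<star> (\<lambda>i j. lucas_coeff (2 * i) j)) i x =
      (\<Sum>k\<le>i. M i k * ((1 / 2 + y) ^ (2 * k) + (1 / 2 - y) ^ (2 * k)))"
    by (simp add: row_eval_mat_mult lower_tri_matrices row_eval_def[of "\<lambda>i j. lucas_coeff (2 * i) j"]
        sum_lucas_coeff x poly_lucas_poly)
  also have "\<dots> = row_eval M i ((y + 1 / 2)\<^sup>2) + row_eval M i ((y - 1 / 2)\<^sup>2)"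
    by (simp add: row_eval_def power_mult distrib_left sum.distrib add.commute power2_commute)
  also have "\<dots> = (1 / 2 + y) ^ (2 * i + 1) + (1 / 2 - y) ^ (2 * i + 1)"
  proof -
    \<comment> \<open>An odd exponent turns -(y - 1/2)^(2i+1) into (1/2 - y)^(2i+1).\<close>
    have "odd (2 * i + 1)"
      by simp
    from power_minus_odd[OF this, of "y - 1 / 2"] show ?thesis
      by (simp only: eq minus_diff_eq add.commute[of "1 / 2"] add_uminus_conv_diff)
  qed
  also have "\<dots> = row_eval (\<lambda>i j. lucas_coeff (2 * i + 1) j) i x"
    unfolding row_eval_def
    by (simp only: sum_lucas_coeff[OF order_refl] x poly_lucas_poly)
  finally show "row_eval (M \<star> (\<lambda>i j. lucas_coeff (2 * i) j)) i x =
      row_eval (\<lambda>i j. lucas_coeff (2 * i + 1) j) i x" .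
qed (use M lower_tri_mat_mult lower_tri_matrices in auto)

section \<open>The tangent numbers\<close>

text \<open>The defining quotient of tanh with z/2 substituted for z, cleared of its denominator and
  multiplied by e^(-z/2) to make it symmetric.\<close>

lemma tangent_gf_half_mult:
  "(tangent_gf oo fps_const (1 / 2) * fps_X) * (fps_exp (1 / 2) + fps_exp (- 1 / 2)) =
     fps_exp (1 / 2) - fps_exp (- 1 / 2)"
proof -
  let ?h = "fps_const (1 / 2) * fps_X :: real fps"
  \<comment> \<open>The constant coefficient of the divisor is 2, so it is a unit and the division
    is exact.\<close>
  have "fps_exp 2 + 1 dvd fps_exp 2 - (1 :: real fps)"
    by (rule unit_imp_dvd) (simp add: fps_is_unit_iff)
  then have "tangent_gf * (fps_exp 2 + 1) = fps_exp 2 - 1"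
    by (simp only: tangent_gf_def dvd_div_mult_self)
  then have "(tangent_gf * (fps_exp 2 + 1)) oo ?h = (fps_exp 2 - 1) oo ?h"
    by simp
  then have "(tangent_gf oo ?h) * (fps_exp 1 + 1) = fps_exp 1 - 1"
    by (simp add: fps_compose_mult_distrib fps_compose_add_distrib fps_compose_sub_distrib
        fps_exp_compose_linear)
  then have "(tangent_gf oo ?h) * ((fps_exp 1 + 1) * fps_exp (- 1 / 2)) =
      (fps_exp 1 - 1) * fps_exp (- 1 / 2)"
    by (simp flip: mult.assoc)
  then show ?thesis
    by (simp add: distrib_right left_diff_distrib flip: fps_exp_add_mult)
qed

text \<open>Coefficient comparison in tanh(z/2) e^(xz): as tanh is odd, only even powers of x occur
  in the Cauchy product.\<close>

lemma row_eval_B_mat: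
  "row_eval B_mat i (x\<^sup>2) =
     fact (2 * i + 1) * fps_nth ((tangent_gf oo fps_const (1 / 2) * fps_X) * fps_exp x) (2 * i + 1)"
proof -
  let ?n = "2 * i + 1"
  define f where "f k = x ^ k / fact k * (tangent_gf $ (?n - k) / 2 ^ (?n - k))" for k
  have "fps_nth ((tangent_gf oo fps_const (1 / 2) * fps_X) * fps_exp x) ?n = (\<Sum>k\<le>?n. f k)"
    by (subst mult.commute)
      (simp add: fps_mult_nth fps_compose_linear f_def power_divide atLeast0AtMost)
  also have "\<dots> = (\<Sum>k\<in>(\<lambda>j. 2 * j) ` {..i}. f k)"
  proof (rule sum.mono_neutral_right)
    show "\<forall>k\<in>{..?n} - (\<lambda>j. 2 * j) ` {..i}. f k = 0"
    proof
      fix k assume k: "k \<in> {..?n} - (\<lambda>j. 2 * j) ` {..i}"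
      \<comment> \<open>Then \<open>?n - k\<close> is even, where the coefficient of tanh
        vanishes.\<close>
      have "odd k"
      proof
        assume "even k"
        then obtain j where "k = 2 * j" ..
        with k show False by auto
      qed
      then show "f k = 0"
        using k by (simp add: f_def tangent_gf_nth_even)
    qed
  qed auto
  also have "\<dots> = (\<Sum>j\<le>i. f (2 * j))"
    by (subst sum.reindex) (auto simp: inj_on_def)
  finally have "fact ?n * fps_nth ((tangent_gf oo fps_const (1 / 2) * fps_X) * fps_exp x) ?n =
      (\<Sum>j\<le>i. fact ?n * f (2 * j))"
    by (simp add: sum_distrib_left)
  also have "\<dots> = row_eval B_mat i (x\<^sup>2)"
    unfolding row_eval_def
  proof (intro sum.cong refl)
    fix j assume "j \<in> {..i}"
    then have le: "j \<le> i" by simp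
    define m where "m = 2 * (i - j) + 1"
    have m: "?n - 2 * j = m" and m_div: "m div 2 = i - j"
      using le by (auto simp: m_def)
    have "real (?n choose (2 * j)) = fact ?n / (fact (2 * j) * fact m)"
      using le m by (subst binomial_fact) auto
    then have "B_mat i j = (-1) ^ (i - j) * ((-1) ^ (i - j) * fact m * (tangent_gf $ m) / 2 ^ m) *
        (fact ?n / (fact (2 * j) * fact m))"
      using le by (simp only: B_mat_def tangent_number_def m_def[symmetric] m_div if_True)
    \<comment> \<open>The sign in \<open>B_mat\<close> and the sign in \<open>tangent_number\<close>
      multiply to 1.\<close>
    moreover have "(-1) ^ (i - j) = (1 :: real) \<or> (-1) ^ (i - j) = (-1 :: real)"
      by (simp add: minus_one_power_iff)
    ultimately have "B_mat i j = fact ?n / fact (2 * j) * (tangent_gf $ m / 2 ^ m)"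
      by (auto simp: mult_ac simp del: fact_Suc)
    then show "fact ?n * f (2 * j) = B_mat i j * (x\<^sup>2) ^ j"
      unfolding f_def m by (simp add: power_mult)
  qed
  finally show ?thesis ..
qed

text \<open>The sum of e^((y+1/2)z) and e^((y-1/2)z) is e^(yz) (e^(z/2) + e^(-z/2)), whose second
  factor cancels the denominator of tanh(z/2).\<close>

lemma B_mat_mult_lucas_even:
  "B_mat \<star> (\<lambda>i j. lucas_coeff (2 * i) j) = (\<lambda>i j. lucas_coeff (2 * i + 1) j)"
proof (rule mat_mult_lucas_even_eq_odd)
  fix i :: nat and y :: real
  let ?t = "tangent_gf oo fps_const (1 / 2) * fps_X"
  have "?t * fps_exp (y + 1 / 2) + ?t * fps_exp (y - 1 / 2) =
      ?t * (fps_exp (1 / 2) + fps_exp (- 1 / 2)) * fps_exp y"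
    using fps_exp_add_mult[of y "1 / 2"] fps_exp_add_mult[of y "- 1 / 2"] by (simp add: algebra_simps)
  also have "\<dots> = fps_exp (y + 1 / 2) - fps_exp (y - 1 / 2)"
    unfolding tangent_gf_half_mult by (simp add: algebra_simps flip: fps_exp_add_mult)
  finally have "fps_nth (?t * fps_exp (y + 1 / 2) + ?t * fps_exp (y - 1 / 2)) (2 * i + 1) =
      fps_nth (fps_exp (y + 1 / 2) - fps_exp (y - 1 / 2)) (2 * i + 1)"
    by (rule arg_cong)
  then have "fps_nth (?t * fps_exp (y + 1 / 2)) (2 * i + 1) +
      fps_nth (?t * fps_exp (y - 1 / 2)) (2 * i + 1) =
      ((y + 1 / 2) ^ (2 * i + 1) - (y - 1 / 2) ^ (2 * i + 1)) / fact (2 * i + 1)"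
    by (simp only: diff_divide_distrib fps_add_nth fps_exp_nth fps_sub_nth of_nat_fact)
  then show "row_eval B_mat i ((y + 1 / 2)\<^sup>2) + row_eval B_mat i ((y - 1 / 2)\<^sup>2) =
      (y + 1 / 2) ^ (2 * i + 1) - (y - 1 / 2) ^ (2 * i + 1)"
    unfolding row_eval_B_mat distrib_left[symmetric] by simp
qed (rule lower_tri_matrices)

section \<open>Generalized Stirling numbers\<close>

text \<open>The recurrence multiplies the row polynomial by \<open>x - w n\<close>.\<close>

lemma row_eval_gen_stirling1: "row_eval (gen_stirling1 w) n x = (\<Prod>j<n. x - w j)"
proof (induction n)
  case (Suc n)
  \<comment> \<open>Column 0 is defined in closed form; here it takes the shape of the general
    recurrence without a left neighbour.\<close>
  have zero: "gen_stirling1 w (Suc n) 0 = - w n * gen_stirling1 w n 0"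
    by (cases n) simp_all
  have "row_eval (gen_stirling1 w) (Suc n) x =
      x * row_eval (gen_stirling1 w) n x -
      w n * (gen_stirling1 w n 0 + (\<Sum>k\<le>n. gen_stirling1 w n (Suc k) * x ^ Suc k))"
    unfolding row_eval_def sum.atMost_Suc_shift zero
    by (simp add: sum_subtractf sum_distrib_left algebra_simps)
  also have "gen_stirling1 w n 0 + (\<Sum>k\<le>n. gen_stirling1 w n (Suc k) * x ^ Suc k) =
      (\<Sum>k\<le>Suc n. gen_stirling1 w n k * x ^ k)"
    by (simp only: sum.atMost_Suc_shift) simp
  also have "\<dots> = row_eval (gen_stirling1 w) n x"
    by (simp add: row_eval_def gen_stirling1_eq_0)
  finally show ?case
    by (simp add: Suc algebra_simps)
qed (simp add: row_eval_def)

text \<open>With p_k the product over j < k, x p_k = p_{k+1} + w(k) p_k; multiplying the expansion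
  of x^n by x thus reproduces the recurrence.\<close>

lemma sum_gen_stirling2:
  "(\<Sum>k\<le>n. gen_stirling2 w n k * (\<Prod>j<k. x - w j)) = x ^ n"
proof (induction n)
  case (Suc n)
  let ?p = "\<lambda>k. \<Prod>j<k. x - w j"
  have zero: "gen_stirling2 w (Suc n) 0 = w 0 * gen_stirling2 w n 0"
    by (cases n) simp_all
  have "(\<Sum>k\<le>Suc n. gen_stirling2 w (Suc n) k * ?p k) =
      (\<Sum>k\<le>n. gen_stirling2 w n k * ?p (Suc k)) +
      (w 0 * gen_stirling2 w n 0 * ?p 0 +
       (\<Sum>k\<le>n. w (Suc k) * gen_stirling2 w n (Suc k) * ?p (Suc k)))"
    unfolding sum.atMost_Suc_shift zero
    by (simp add: sum.distrib distrib_right del: prod.lessThan_Suc)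
  also have "w 0 * gen_stirling2 w n 0 * ?p 0 +
       (\<Sum>k\<le>n. w (Suc k) * gen_stirling2 w n (Suc k) * ?p (Suc k)) =
      (\<Sum>k\<le>Suc n. w k * gen_stirling2 w n k * ?p k)"
    by (simp only: sum.atMost_Suc_shift)
  also have "\<dots> = (\<Sum>k\<le>n. w k * gen_stirling2 w n k * ?p k)"
    by (simp add: gen_stirling2_eq_0)
  also have "(\<Sum>k\<le>n. gen_stirling2 w n k * ?p (Suc k)) + \<dots> =
      x * (\<Sum>k\<le>n. gen_stirling2 w n k * ?p k)"
    by (simp add: sum_distrib_left algebra_simps flip: sum.distrib)
  finally show ?case
    by (simp add: Suc)
qed simp

text \<open>
  Both products are multiples of $q = \prod_{|j|<k} (y + j)$: the first is $(y+k)\,q$ and the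
  second is $(y-k)\,q$. The claim is the same statement without division by $y$ or $y \pm k$.
\<close>

lemma prod_weight_shift:
  "(y - real k) * (\<Prod>j<k. (y + 1 / 2)\<^sup>2 - weight j) =
   (y + real k) * (\<Prod>j<k. (y - 1 / 2)\<^sup>2 - weight j)"
proof (induction k)
  case (Suc k)
  \<comment> \<open>Differences of squares, as \<open>weight k\<close> is the square of k +
    1/2.\<close>
  have 1: "(y + 1 / 2)\<^sup>2 - weight k = (y - real k) * (y + real (Suc k))"
    and 2: "(y - 1 / 2)\<^sup>2 - weight k = (y - real (Suc k)) * (y + real k)"
    by (simp_all add: weight_def power2_eq_square field_simps)
  show ?case
    using arg_cong[OF Suc, of "\<lambda>z. (y - real (Suc k)) * (y + real (Suc k)) * z"]
    by (simp only: prod.lessThan_Suc 1 2 mult_ac)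
qed simp

text \<open>Writing P and Q for the two products, left side minus right side is (y - k) P - (y + k)
  Q, which vanishes by \<open>prod_weight_shift\<close>.\<close>

lemma central_difference_prod_weight:
  "(y + 1 / 2) * (\<Prod>j<k. (y + 1 / 2)\<^sup>2 - weight j) -
   (y - 1 / 2) * (\<Prod>j<k. (y - 1 / 2)\<^sup>2 - weight j) =
   (2 * real k + 1) / 2 *
     ((\<Prod>j<k. (y + 1 / 2)\<^sup>2 - weight j) + (\<Prod>j<k. (y - 1 / 2)\<^sup>2 - weight j))"
  using prod_weight_shift[of y k] by (simp add: field_simps)

lemma stirling_product_eq:
  "stirling_U \<star> (\<lambda>i j. of_bool (i = j) * ((2 * real j + 1) / 2)) =
   (\<lambda>i j. stirling_U i j * ((2 * real j + 1) / 2))"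
proof (intro ext)
  fix i j
  have "(stirling_U \<star> (\<lambda>i j. of_bool (i = j) * ((2 * real j + 1) / 2))) i j =
      (\<Sum>k\<le>i. if k = j then stirling_U i j * ((2 * real j + 1) / 2) else 0)"
    unfolding mat_mult_def by (intro sum.cong) auto
  then show "(stirling_U \<star> (\<lambda>i j. of_bool (i = j) * ((2 * real j + 1) / 2))) i j =
      stirling_U i j * ((2 * real j + 1) / 2)"
    by (simp add: gen_stirling2_eq_0)
qed

text \<open>Both sides of the difference equation are expanded with the coefficients U(i,k), and
  \<open>central_difference_prod_weight\<close> matches them term by term.\<close>

lemma stirling_product_mult_lucas_even:
  "(stirling_U \<star> (\<lambda>i j. of_bool (i = j) * ((2 * real j + 1) / 2)) \<star> stirling_u) \<star>
     (\<lambda>i j. lucas_coeff (2 * i) j) = (\<lambda>i j. lucas_coeff (2 * i + 1) j)"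
  unfolding stirling_product_eq
proof (rule mat_mult_lucas_even_eq_odd)
  let ?UD = "\<lambda>i j. stirling_U i j * ((2 * real j + 1) / 2)"
  show "lower_tri (?UD \<star> stirling_u)"
    by (intro lower_tri_mat_mult lower_tri_matrices) (simp add: lower_tri_def gen_stirling2_eq_0)
  fix i :: nat and y :: real
  let ?p = "\<lambda>k x. \<Prod>j<k. x\<^sup>2 - weight j"
  have power: "x ^ (2 * i + 1) = (\<Sum>k\<le>i. stirling_U i k * (x * ?p k x))" for x
  proof -
    have "x ^ (2 * i + 1) = x * (x\<^sup>2) ^ i"
      by (simp add: power_mult)
    then show ?thesis
      by (simp add: sum_distrib_left mult_ac flip: sum_gen_stirling2[of weight i "x\<^sup>2"])
  qed
  have "row_eval (?UD \<star> stirling_u) i ((y + 1 / 2)\<^sup>2) + row_eval (?UD \<star> stirling_u) i ((y - 1 / 2)\<^sup>2) =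
      (\<Sum>k\<le>i. stirling_U i k * ((2 * real k + 1) / 2 * (?p k (y + 1 / 2) + ?p k (y - 1 / 2))))"
    by (simp only: row_eval_mat_mult lower_tri_matrices row_eval_gen_stirling1 distrib_left
        sum.distrib mult.assoc)
  also have "\<dots> = (y + 1 / 2) ^ (2 * i + 1) - (y - 1 / 2) ^ (2 * i + 1)"
    by (simp only: power central_difference_prod_weight[symmetric] right_diff_distrib sum_subtractf)
  finally show "row_eval (?UD \<star> stirling_u) i ((y + 1 / 2)\<^sup>2) +
      row_eval (?UD \<star> stirling_u) i ((y - 1 / 2)\<^sup>2) =
      (y + 1 / 2) ^ (2 * i + 1) - (y - 1 / 2) ^ (2 * i + 1)" .
qed

theorem theorem5p2:
  shows "invertible_ltri (\<lambda>i j. lucas_coeff (2 * i) j)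
    \<and> B_mat = (\<lambda>i j. lucas_coeff (2 * i + 1) j) \<star> ltri_inv (\<lambda>i j. lucas_coeff (2 * i) j)
    \<and> B_mat = stirling_U \<star> (\<lambda>i j. of_bool (i = j) * ((2 * real j + 1) / 2)) \<star> stirling_u"
proof -
  let ?L = "\<lambda>i j. lucas_coeff (2 * i) j"
  let ?S = "stirling_U \<star> (\<lambda>i j. of_bool (i = j) * ((2 * real j + 1) / 2)) \<star> stirling_u"
  have L: "lower_tri ?L"
    by (rule lower_tri_matrices)
  have inv: "is_inverse ?L (ltri_right_inv ?L)"
    by (rule is_inverse_ltri_right_inv[OF L]) (simp add: lucas_coeff_diag)
  \<comment> \<open>A lower triangular matrix is recovered from its product with \<open>?L\<close>;
    \<open>B_mat\<close> and \<open>?S\<close> have the same product, hence coincide.\<close>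
  have cancel: "M = (M \<star> ?L) \<star> ltri_inv ?L" if "lower_tri M" for M
    using inv that by (simp add: ltri_inv_eqI[OF L inv] mat_mult_assoc[OF that L] is_inverse_def
        mat_one_right)
  have "lower_tri ?S"
    by (intro lower_tri_mat_mult lower_tri_matrices) (simp add: lower_tri_def)
  then have "B_mat = (\<lambda>i j. lucas_coeff (2 * i + 1) j) \<star> ltri_inv ?L"
    and "?S = (\<lambda>i j. lucas_coeff (2 * i + 1) j) \<star> ltri_inv ?L"
    using cancel[of B_mat] cancel[of ?S]
    by (simp_all only: lower_tri_matrices B_mat_mult_lucas_even stirling_product_mult_lucas_even)
  then show ?thesis
    using L inv by (auto simp: invertible_ltri_def)
qed

end
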